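(* One has $$e(\ell_2,\ell_1)\geq\sqrt{2},$$ where $e(\ell_2,\ell_1):=\sup\{e(\ell_2,S;\ell_1):S\subset\ell_2\}\in[1,+\infty]$.
   Context: For metric spaces $(X,d_X)$, $(Y,d_Y)$ and a map $f\colon S\to Y$ on a subset $S\subset X$, $\operatorname{Lip}(f):=\inf\{L\geq0:d_Y(f(x),f(x'))\leq L\,d_X(x,x')\ \forall x,x'\in S\}$ (with $\inf\varnothing=+\infty$), and $f$ is Lipschitz if $\operatorname{Lip}(f)<\infty$. For $S\subset X$, $e(X,S;Y)$ denotes the infimum (with $\inf\varnothing=+\infty$) of all real numbers $D\geq1$ such that every Lipschitz map $f\colon S\to Y$ has a Lipschitz extension $\overline{f}\colon X\to Y$ with $\operatorname{Lip}(\overline{f})\leq D\operatorname{Lip}(f)$. Here $\ell_2$ and $\ell_1$ are the usual (real) sequence spaces with the metrics induced by their norms. *)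

theory Defs
  imports "HOL-Analysis.Analysis"
begin

section \<open>The real sequence spaces \<open>\<ell>\<^sub>1\<close> and \<open>\<ell>\<^sub>2\<close>\<close>

typedef ell1 = "{x :: nat \<Rightarrow> real. summable (\<lambda>n. \<bar>x n\<bar>)}"
  morphisms ell1_nth Abs_ell1
  by (rule exI[of _ "\<lambda>_. 0"]) simp

setup_lifting type_definition_ell1

lemma summable_abs_add:
  fixes x y :: "nat \<Rightarrow> real"
  assumes "summable (\<lambda>n. \<bar>x n\<bar>)" "summable (\<lambda>n. \<bar>y n\<bar>)"
  shows "summable (\<lambda>n. \<bar>x n + y n\<bar>)"
  by (rule summable_comparison_test'[OF summable_add[OF assms], of 0]) auto

instantiation ell1 :: real_normed_vector
begin

lift_definition zero_ell1 :: ell1 is "\<lambda>_. 0" by simp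

lift_definition plus_ell1 :: "ell1 \<Rightarrow> ell1 \<Rightarrow> ell1" is "\<lambda>x y n. x n + y n"
  by (rule summable_abs_add)

lift_definition uminus_ell1 :: "ell1 \<Rightarrow> ell1" is "\<lambda>x n. - x n" by simp

lift_definition minus_ell1 :: "ell1 \<Rightarrow> ell1 \<Rightarrow> ell1" is "\<lambda>x y n. x n - y n"
  subgoal for x y using summable_abs_add[of x "\<lambda>n. - y n"] by simp
  done

lift_definition scaleR_ell1 :: "real \<Rightarrow> ell1 \<Rightarrow> ell1" is "\<lambda>c x n. c * x n"
  by (simp add: abs_mult summable_mult)

lift_definition norm_ell1 :: "ell1 \<Rightarrow> real" is "\<lambda>x. \<Sum>n. \<bar>x n\<bar>" .

definition dist_ell1 :: "ell1 \<Rightarrow> ell1 \<Rightarrow> real"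
  where "dist_ell1 x y = norm (x - y)"

definition sgn_ell1 :: "ell1 \<Rightarrow> ell1"
  where "sgn_ell1 x = inverse (norm x) *\<^sub>R x"

definition uniformity_ell1 :: "(ell1 \<times> ell1) filter"
  where "uniformity_ell1 = (INF e\<in>{0<..}. principal {(x, y). dist x y < e})"

definition open_ell1 :: "ell1 set \<Rightarrow> bool"
  where "open_ell1 U \<longleftrightarrow> (\<forall>x\<in>U. eventually (\<lambda>(x', y). x' = x \<longrightarrow> y \<in> U) uniformity)"

instance
proof
  fix x y :: ell1 and a :: real
  show "norm x = 0 \<longleftrightarrow> x = 0"
    by transfer (auto simp: suminf_eq_zero_iff)
  show "norm (x + y) \<le> norm x + norm y"
  proof transfer
    fix x y :: "nat \<Rightarrow> real"
    assume *: "summable (\<lambda>n. \<bar>x n\<bar>)" "summable (\<lambda>n. \<bar>y n\<bar>)"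
    have "(\<Sum>n. \<bar>x n + y n\<bar>) \<le> (\<Sum>n. \<bar>x n\<bar> + \<bar>y n\<bar>)"
      by (rule suminf_le[OF _ summable_abs_add summable_add]) (use * in auto)
    then show "(\<Sum>n. \<bar>x n + y n\<bar>) \<le> (\<Sum>n. \<bar>x n\<bar>) + (\<Sum>n. \<bar>y n\<bar>)"
      using * by (simp add: suminf_add)
  qed
  show "norm (a *\<^sub>R x) = \<bar>a\<bar> * norm x"
    by transfer (simp add: abs_mult suminf_mult)
qed (rule dist_ell1_def sgn_ell1_def uniformity_ell1_def open_ell1_def |
     (transfer; simp add: fun_eq_iff algebra_simps))+

end

typedef ell2 = "{x :: nat \<Rightarrow> real. summable (\<lambda>n. (x n)\<^sup>2)}"
  morphisms ell2_nth Abs_ell2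
  by (rule exI[of _ "\<lambda>_. 0"]) simp

setup_lifting type_definition_ell2

lemma summable_square_add:
  fixes x y :: "nat \<Rightarrow> real"
  assumes "summable (\<lambda>n. (x n)\<^sup>2)" "summable (\<lambda>n. (y n)\<^sup>2)"
  shows "summable (\<lambda>n. (x n + y n)\<^sup>2)"
proof (rule summable_comparison_test')
  show "summable (\<lambda>n. 2 * (x n)\<^sup>2 + 2 * (y n)\<^sup>2)"
    using assms by (intro summable_add summable_mult)
  fix n
  have "(x n + y n)\<^sup>2 \<le> 2 * (x n)\<^sup>2 + 2 * (y n)\<^sup>2"
    using sum_squares_bound[of "x n" "y n"] by (simp add: power2_sum)
  then show "norm ((x n + y n)\<^sup>2) \<le> 2 * (x n)\<^sup>2 + 2 * (y n)\<^sup>2"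
    by simp
qed

lemma sqrt_suminf_square_triangle:
  fixes x y :: "nat \<Rightarrow> real"
  assumes x: "summable (\<lambda>n. (x n)\<^sup>2)" and y: "summable (\<lambda>n. (y n)\<^sup>2)"
  shows "sqrt (\<Sum>n. (x n + y n)\<^sup>2) \<le> sqrt (\<Sum>n. (x n)\<^sup>2) + sqrt (\<Sum>n. (y n)\<^sup>2)"
proof (rule LIMSEQ_le)
  show "(\<lambda>N. sqrt (\<Sum>n<N. (x n + y n)\<^sup>2)) \<longlonglongrightarrow> sqrt (\<Sum>n. (x n + y n)\<^sup>2)"
    by (intro tendsto_real_sqrt summable_LIMSEQ summable_square_add x y)
  show "(\<lambda>N. sqrt (\<Sum>n<N. (x n)\<^sup>2) + sqrt (\<Sum>n<N. (y n)\<^sup>2))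
      \<longlonglongrightarrow> sqrt (\<Sum>n. (x n)\<^sup>2) + sqrt (\<Sum>n. (y n)\<^sup>2)"
    by (intro tendsto_add tendsto_real_sqrt summable_LIMSEQ x y)
  show "\<exists>N0. \<forall>N\<ge>N0. sqrt (\<Sum>n<N. (x n + y n)\<^sup>2)
      \<le> sqrt (\<Sum>n<N. (x n)\<^sup>2) + sqrt (\<Sum>n<N. (y n)\<^sup>2)"
    using L2_set_triangle_ineq[of x y] by (auto simp: L2_set_def)
qed

instantiation ell2 :: real_normed_vector
begin

lift_definition zero_ell2 :: ell2 is "\<lambda>_. 0" by simp

lift_definition plus_ell2 :: "ell2 \<Rightarrow> ell2 \<Rightarrow> ell2" is "\<lambda>x y n. x n + y n"
  by (rule summable_square_add)

lift_definition uminus_ell2 :: "ell2 \<Rightarrow> ell2" is "\<lambda>x n. - x n" by simp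

lift_definition minus_ell2 :: "ell2 \<Rightarrow> ell2 \<Rightarrow> ell2" is "\<lambda>x y n. x n - y n"
  subgoal for x y using summable_square_add[of x "\<lambda>n. - y n"] by simp
  done

lift_definition scaleR_ell2 :: "real \<Rightarrow> ell2 \<Rightarrow> ell2" is "\<lambda>c x n. c * x n"
  by (simp add: power_mult_distrib summable_mult)

lift_definition norm_ell2 :: "ell2 \<Rightarrow> real" is "\<lambda>x. sqrt (\<Sum>n. (x n)\<^sup>2)" .

definition dist_ell2 :: "ell2 \<Rightarrow> ell2 \<Rightarrow> real"
  where "dist_ell2 x y = norm (x - y)"

definition sgn_ell2 :: "ell2 \<Rightarrow> ell2"
  where "sgn_ell2 x = inverse (norm x) *\<^sub>R x"

definition uniformity_ell2 :: "(ell2 \<times> ell2) filter"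
  where "uniformity_ell2 = (INF e\<in>{0<..}. principal {(x, y). dist x y < e})"

definition open_ell2 :: "ell2 set \<Rightarrow> bool"
  where "open_ell2 U \<longleftrightarrow> (\<forall>x\<in>U. eventually (\<lambda>(x', y). x' = x \<longrightarrow> y \<in> U) uniformity)"

instance
proof
  fix x y :: ell2 and a :: real
  show "norm x = 0 \<longleftrightarrow> x = 0"
    by transfer (auto simp: suminf_eq_zero_iff)
  show "norm (x + y) \<le> norm x + norm y"
    by transfer (rule sqrt_suminf_square_triangle)
  show "norm (a *\<^sub>R x) = \<bar>a\<bar> * norm x"
    by transfer (simp add: power_mult_distrib suminf_mult real_sqrt_mult)
qed (rule dist_ell2_def sgn_ell2_def uniformity_ell2_def open_ell2_def |
     (transfer; simp add: fun_eq_iff algebra_simps))+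

end

section \<open>Lipschitz constants and extension constants\<close>

text \<open>
  A map on a subset \<open>S\<close> is represented by a total function of which only the values on \<open>S\<close>
  matter. All infima are taken in the extended reals, where the infimum of the empty set
  is \<open>\<infinity>\<close>.
\<close>

definition Lip :: "'a::metric_space set \<Rightarrow> ('a \<Rightarrow> 'b::metric_space) \<Rightarrow> ereal"
  where "Lip S f = (INF L\<in>{L. L-lipschitz_on S f}. ereal L)"

text \<open>The type argument \<open>TYPE('b)\<close> is the target space; the source space is the type \<open>'a\<close>.\<close>

definition ext_const :: "'a::metric_space set \<Rightarrow> 'b::metric_space itself \<Rightarrow> ereal"
  where "ext_const S (_ :: 'b itself) =
    (INF D\<in>{D::real. D \<ge> 1 \<and>
        (\<forall>f :: 'a \<Rightarrow> 'b. Lip S f < \<infinity> \<longrightarrow>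
          (\<exists>g :: 'a \<Rightarrow> 'b. (\<forall>x\<in>S. g x = f x) \<and> Lip UNIV g < \<infinity> \<and>
            Lip UNIV g \<le> ereal D * Lip S f))}. ereal D)"

definition abs_ext_const :: "'a::metric_space itself \<Rightarrow> 'b::metric_space itself \<Rightarrow> ereal"
  where "abs_ext_const (_ :: 'a itself) (_ :: 'b itself) =
    (SUP S :: 'a set. ext_const S TYPE('b))"

end

theory Submission
  imports Defs
begin

text \<open>
  The bad set is the orthonormal basis \<open>e\<^sub>0, e\<^sub>1, \<dots>\<close> of \<open>\<ell>\<^sub>2\<close>, and the only point to which maps
  have to be extended is the origin. The basis vectors have mutual distance \<open>\<surd>2\<close> but distance
  only \<open>1\<close> from the origin. In \<open>\<ell>\<^sub>1\<close>, in contrast, there are many points with mutual distance at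
  most \<open>\<surd>2\<close> for which no point is much closer than \<open>\<surd>2\<close> to all of them: the
  multiples \<open>\<surd>2 r\<^sub>i\<close> of the first \<open>n\<close> Rademacher functions in \<open>L\<^sub>1\<close> of the uniform probability
  on \<open>2\<^sup>n\<close> points, a space that embeds isometrically into \<open>\<ell>\<^sub>1\<close>.

  Both properties come from orthogonality of the \<open>r\<^sub>i\<close>. Since these are signs,
  \<open>\<bar>r\<^sub>i - r\<^sub>j\<bar> = 1 - r\<^sub>i r\<^sub>j\<close>, so for \<open>i \<noteq> j\<close> the distance of \<open>r\<^sub>i\<close> and \<open>r\<^sub>j\<close> is \<open>1\<close>. For the other property, a
  number \<open>t\<close> has total distance at least \<open>n - \<bar>\<Sum>\<^sub>i r\<^sub>i(w)\<bar>\<close> from the \<open>n\<close> signs \<open>r\<^sub>i(w)\<close>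
  (\<open>sum_abs_diff_signs_ge\<close>), and the mean of \<open>\<bar>\<Sum>\<^sub>i r\<^sub>i\<bar>\<close> is at most its quadratic mean \<open>\<surd>n\<close>
  (\<open>sum_abs_sum_rad_le\<close>). Hence the mean distance of any point from the \<open>\<surd>2 r\<^sub>i\<close> is at
  least \<open>\<surd>2 (1 - 1/\<surd>n)\<close> (\<open>sum_dist_rad_ell1_ge\<close>), which is therefore a lower bound for the
  extension constant; let \<open>n\<close> tend to infinity.
\<close>

section \<open>Rademacher signs\<close>

text \<open>
  On \<open>{..<2 ^ n}\<close> only the first \<open>n\<close> of these are the Rademacher functions, the sign being that of
  the binary digit with index \<open>i\<close> of \<open>w\<close>. The others are constantly \<open>1\<close> there.
\<close>

definition rad :: "nat \<Rightarrow> nat \<Rightarrow> real"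
  where "rad i w = (- 1) ^ (w div 2 ^ i)"

lemma rad_cases: "rad i w = 1 \<or> rad i w = - 1"
  unfolding rad_def by (cases "even (w div 2 ^ i)") auto

lemma rad_square [simp]: "rad i w * rad i w = 1"
  using rad_cases[of i w] by auto

lemma rad_0_double [simp]: "rad 0 (2 * w) = 1" "rad 0 (Suc (2 * w)) = - 1"
  by (simp_all add: rad_def)

lemma rad_Suc_double [simp]:
  "rad (Suc i) (2 * w) = rad i w" "rad (Suc i) (Suc (2 * w)) = rad i w"
  by (simp_all add: rad_def div_mult2_eq)

lemma sum_lessThan_double:
  fixes f :: "nat \<Rightarrow> 'a::comm_monoid_add"
  shows "(\<Sum>w<2 * N. f w) = (\<Sum>w<N. f (2 * w) + f (Suc (2 * w)))"
  by (induction N) (simp_all add: add.assoc)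

text \<open>
  Splitting \<open>w\<close> into its last binary digit and the others, \<open>rad 0\<close> depends on the
  last digit only and all other signs do not depend on it. The index \<open>j\<close> need not be below \<open>n\<close>,
  so that also the constant \<open>1\<close> is orthogonal to the Rademacher functions.
\<close>

lemma rad_orthogonal:
  assumes "i < n" "i < j"
  shows "(\<Sum>w<2 ^ n. rad i w * rad j w) = 0"
  using assms
proof (induction n arbitrary: i j)
  case (Suc n)
  obtain j' where j: "j = Suc j'"
    using Suc.prems by (cases j) auto
  show ?case
  proof (cases i)
    case 0
    then show ?thesis by (simp add: j sum_lessThan_double)
  next
    case (Suc i')
    then have "(\<Sum>w<2 ^ n. rad i' w * rad j' w) = 0"
      using Suc.IH Suc.prems j by simp
    then show ?thesis
      using Suc by (simp add: j sum_lessThan_double flip: sum_distrib_left)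
  qed
qed simp

lemma sum_abs_diff_rad_le: "(\<Sum>w<2 ^ n. \<bar>rad i w - rad j w\<bar>) \<le> 2 ^ n"
proof -
  have abs_eq: "\<bar>rad i w - rad j w\<bar> = 1 - rad i w * rad j w" for i j w
    using rad_cases[of i w] rad_cases[of j w] by auto
  have lt: "(\<Sum>w<2 ^ n. \<bar>rad i w - rad j w\<bar>) \<le> 2 ^ n" if "i < j" for i j
  proof (cases "i < n")
    case True
    then show ?thesis
      using rad_orthogonal[OF True that] by (simp add: abs_eq sum_subtractf)
  next
    case False
    have "rad k w = 1" if "n \<le> k" "w < 2 ^ n" for k w
    proof -
      have "w < 2 ^ k"
        using that by (meson le_trans linorder_not_le one_le_numeral power_increasing)
      then show ?thesis by (simp add: rad_def)
    qed
    then show ?thesis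
      using False that by (simp add: abs_eq)
  qed
  consider "i < j" | "i = j" | "j < i" by linarith
  then show ?thesis
    using lt[of i j] lt[of j i] by cases (auto simp: abs_minus_commute)
qed

text \<open>
  Cauchy--Schwarz against the constant \<open>1\<close>; by orthogonality the sum of the squares
  is \<open>n * 2 ^ n\<close>.
\<close>

lemma sum_abs_sum_rad_le: "(\<Sum>w<2 ^ n. \<bar>\<Sum>i<n. rad i w\<bar>) \<le> 2 ^ n * sqrt n"
proof -
  have orth: "(\<Sum>w<2 ^ n. rad i w * rad j w) = (if i = j then 2 ^ n else 0)"
    if "i < n" "j < n" for i j
    using rad_orthogonal[of i n j] rad_orthogonal[of j n i] that
    by (cases i j rule: linorder_cases) (auto simp: mult.commute)
  have "(\<Sum>w<2 ^ n. (\<Sum>i<n. rad i w)\<^sup>2) = (\<Sum>w<2 ^ n. \<Sum>i<n. \<Sum>j<n. rad i w * rad j w)"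
    by (simp add: power2_eq_square sum_product)
  also have "\<dots> = (\<Sum>i<n. \<Sum>j<n. \<Sum>w<2 ^ n. rad i w * rad j w)"
    by (simp only: sum.swap[of _ _ "{..<2 ^ n}"])
  also have "\<dots> = (\<Sum>i<n. \<Sum>j<n. if i = j then 2 ^ n else 0)"
    by (intro sum.cong refl orth) auto
  also have "\<dots> = n * 2 ^ n"
    by simp
  finally have sq: "(\<Sum>w<2 ^ n. (\<Sum>i<n. rad i w)\<^sup>2) = n * 2 ^ n" .
  have "(\<Sum>w<2 ^ n. \<bar>\<Sum>i<n. rad i w\<bar>)
      \<le> L2_set (\<lambda>_::nat. 1) {..<2 ^ n} * L2_set (\<lambda>w. \<Sum>i<n. rad i w) {..<2 ^ n}"
    using L2_set_mult_ineq[of "\<lambda>_. 1" "\<lambda>w. \<Sum>i<n. rad i w" "{..<2 ^ n}"] by simp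
  also have "\<dots> = 2 ^ n * sqrt n"
    by (simp add: L2_set_def sq real_sqrt_mult)
  finally show ?thesis .
qed

text \<open>
  For \<open>\<bar>t\<bar> \<le> c\<close> the inequality \<open>\<bar>t - c s\<^sub>i\<bar> \<ge> c - t s\<^sub>i\<close> can be summed; outside of this
  interval all distances become smaller when \<open>t\<close> moves to the nearest end point.
\<close>

lemma sum_abs_diff_signs_ge:
  fixes s :: "'a \<Rightarrow> real"
  assumes "c \<ge> 0" and sgn: "\<And>i. s i = 1 \<or> s i = - 1"
  shows "c * (card A - \<bar>\<Sum>i\<in>A. s i\<bar>) \<le> (\<Sum>i\<in>A. \<bar>t - c * s i\<bar>)"
proof -
  define u where "u = max (- c) (min c t)"
  have "u * (\<Sum>i\<in>A. s i) \<le> c * \<bar>\<Sum>i\<in>A. s i\<bar>"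
  proof -
    have "\<bar>u\<bar> \<le> c"
      using \<open>c \<ge> 0\<close> by (auto simp: u_def)
    then have "\<bar>u\<bar> * \<bar>\<Sum>i\<in>A. s i\<bar> \<le> c * \<bar>\<Sum>i\<in>A. s i\<bar>"
      by (intro mult_right_mono) auto
    then show ?thesis
      using abs_ge_self[of "u * (\<Sum>i\<in>A. s i)"] by (simp add: abs_mult)
  qed
  then have "c * (card A - \<bar>\<Sum>i\<in>A. s i\<bar>) \<le> (\<Sum>i\<in>A. c - u * s i)"
    by (simp add: sum_subtractf sum_distrib_left algebra_simps)
  also have "\<dots> \<le> (\<Sum>i\<in>A. \<bar>t - c * s i\<bar>)"
  proof (rule sum_mono)
    show "c - u * s i \<le> \<bar>t - c * s i\<bar>" for i
      using sgn[of i] \<open>c \<ge> 0\<close> by (auto simp: u_def)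
  qed
  finally show ?thesis .
qed

section \<open>Rademacher functions in \<open>\<ell>\<^sub>1\<close>\<close>

lift_definition rad_ell1 :: "nat \<Rightarrow> nat \<Rightarrow> ell1"
  is "\<lambda>n i w. if w < 2 ^ n then sqrt 2 / 2 ^ n * rad i w else 0"
  by (rule summable_finite[of "{..<2 ^ n}" for n]) auto

lemma dist_rad_ell1_le: "dist (rad_ell1 n i) (rad_ell1 n j) \<le> sqrt 2"
proof -
  have "dist (rad_ell1 n i) (rad_ell1 n j)
      = (\<Sum>w. \<bar>ell1_nth (rad_ell1 n i) w - ell1_nth (rad_ell1 n j) w\<bar>)"
    by (simp add: dist_norm norm_ell1.rep_eq minus_ell1.rep_eq)
  also have "\<dots> = (\<Sum>w<2 ^ n. \<bar>ell1_nth (rad_ell1 n i) w - ell1_nth (rad_ell1 n j) w\<bar>)"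
    by (rule suminf_finite) (auto simp: rad_ell1.rep_eq)
  also have "\<dots> = (\<Sum>w<2 ^ n. sqrt 2 / 2 ^ n * \<bar>rad i w - rad j w\<bar>)"
    by (intro sum.cong) (auto simp: rad_ell1.rep_eq abs_mult
      simp flip: right_diff_distrib diff_divide_distrib)
  also have "\<dots> = sqrt 2 / 2 ^ n * (\<Sum>w<2 ^ n. \<bar>rad i w - rad j w\<bar>)"
    by (simp add: sum_distrib_left)
  also have "\<dots> \<le> sqrt 2 / 2 ^ n * 2 ^ n"
    by (intro mult_left_mono sum_abs_diff_rad_le) auto
  finally show ?thesis by simp
qed

lemma sum_dist_rad_ell1_ge: "sqrt 2 * (n - sqrt n) \<le> (\<Sum>i<n. dist y (rad_ell1 n i))"
proof -
  let ?c = "sqrt 2 / 2 ^ n"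
  have dist_ge: "(\<Sum>w<2 ^ n. \<bar>ell1_nth y w - ?c * rad i w\<bar>) \<le> dist y (rad_ell1 n i)" for i
  proof -
    have "(\<Sum>w<2 ^ n. \<bar>ell1_nth y w - ?c * rad i w\<bar>)
        = (\<Sum>w<2 ^ n. \<bar>ell1_nth (y - rad_ell1 n i) w\<bar>)"
      by (intro sum.cong) (auto simp: rad_ell1.rep_eq minus_ell1.rep_eq)
    also have "\<dots> \<le> (\<Sum>w. \<bar>ell1_nth (y - rad_ell1 n i) w\<bar>)"
      using ell1_nth[of "y - rad_ell1 n i"] by (intro sum_le_suminf) auto
    finally show ?thesis
      by (simp add: dist_norm norm_ell1.rep_eq)
  qed
  have "sqrt 2 * (n - sqrt n) = ?c * (2 ^ n * n - 2 ^ n * sqrt n)"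
    by (simp flip: right_diff_distrib)
  also have "\<dots> \<le> ?c * (2 ^ n * n - (\<Sum>w<2 ^ n. \<bar>\<Sum>i<n. rad i w\<bar>))"
    by (intro mult_left_mono diff_left_mono sum_abs_sum_rad_le) auto
  also have "\<dots> = (\<Sum>w<2 ^ n. ?c * (n - \<bar>\<Sum>i<n. rad i w\<bar>))"
    by (simp only: sum_distrib_left[symmetric] sum_subtractf) simp
  also have "\<dots> \<le> (\<Sum>w<2 ^ n. \<Sum>i<n. \<bar>ell1_nth y w - ?c * rad i w\<bar>)"
  proof (rule sum_mono)
    show "?c * (n - \<bar>\<Sum>i<n. rad i w\<bar>) \<le> (\<Sum>i<n. \<bar>ell1_nth y w - ?c * rad i w\<bar>)" for w
      using sum_abs_diff_signs_ge[of ?c "\<lambda>i. rad i w" "{..<n}" "ell1_nth y w"] rad_cases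
      by simp
  qed
  also have "\<dots> = (\<Sum>i<n. \<Sum>w<2 ^ n. \<bar>ell1_nth y w - ?c * rad i w\<bar>)"
    by (rule sum.swap)
  also have "\<dots> \<le> (\<Sum>i<n. dist y (rad_ell1 n i))"
    by (intro sum_mono dist_ge)
  finally show ?thesis .
qed

section \<open>The orthonormal basis of \<open>\<ell>\<^sub>2\<close>\<close>

lift_definition unit_ell2 :: "nat \<Rightarrow> ell2" is "\<lambda>i k. if k = i then 1 else 0"
  by (rule summable_finite[of "{i}" for i]) auto

lemma norm_unit_ell2: "norm (unit_ell2 i) = 1"
proof -
  have "(\<Sum>k. (ell2_nth (unit_ell2 i) k)\<^sup>2) = (\<Sum>k\<in>{i}. (ell2_nth (unit_ell2 i) k)\<^sup>2)"
    by (rule suminf_finite) (auto simp: unit_ell2.rep_eq)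
  then show ?thesis
    by (simp add: norm_ell2.rep_eq unit_ell2.rep_eq)
qed

lemma dist_unit_ell2: "dist (unit_ell2 i) (unit_ell2 j) = (if i = j then 0 else sqrt 2)"
proof (cases "i = j")
  case False
  have "(\<Sum>k. (ell2_nth (unit_ell2 i - unit_ell2 j) k)\<^sup>2)
      = (\<Sum>k\<in>{i, j}. (ell2_nth (unit_ell2 i - unit_ell2 j) k)\<^sup>2)"
    by (rule suminf_finite) (auto simp: unit_ell2.rep_eq minus_ell2.rep_eq)
  then show ?thesis
    using False by (simp add: dist_norm norm_ell2.rep_eq unit_ell2.rep_eq minus_ell2.rep_eq)
qed simp

lemma inj_unit_ell2: "inj unit_ell2"
proof (rule injI)
  show "i = j" if "unit_ell2 i = unit_ell2 j" for i j
    using dist_unit_ell2[of i j] that by (auto split: if_splits)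
qed

section \<open>Lower bounds for extension constants\<close>

lemma dist_le_of_Lip_le:
  assumes "Lip S g \<le> ereal D" "x \<in> S" "y \<in> S"
  shows "dist (g x) (g y) \<le> D * dist x y"
proof (rule field_le_epsilon)
  fix e :: real
  assume "e > 0"
  define d where "d = e / (dist x y + 1)"
  have "d > 0"
    using \<open>e > 0\<close> by (simp add: d_def add_nonneg_pos)
  then have "Lip S g < ereal (D + d)"
    using assms(1) by (simp add: le_less_trans)
  then obtain L where L: "L-lipschitz_on S g" "L < D + d"
    by (auto simp: Lip_def INF_less_iff)
  have "dist (g x) (g y) \<le> L * dist x y"
    using lipschitz_onD[OF L(1)] assms by blast
  also have "\<dots> \<le> (D + d) * dist x y"
    using L(2) by (intro mult_right_mono) auto
  also have "\<dots> \<le> D * dist x y + d * (dist x y + 1)"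
    using \<open>d > 0\<close> by (simp add: algebra_simps)
  also have "d * (dist x y + 1) = e"
    using zero_le_dist[of x y] by (simp add: d_def add_nonneg_eq_0_iff)
  finally show "dist (g x) (g y) \<le> D * dist x y + e" .
qed

lemma ext_const_geI:
  assumes "\<And>D. D \<ge> 1 \<Longrightarrow>
    (\<And>f :: 'a \<Rightarrow> 'b. 1-lipschitz_on S f \<Longrightarrow>
      \<exists>g. (\<forall>x\<in>S. g x = f x) \<and> (\<forall>x y. dist (g x) (g y) \<le> D * dist x y)) \<Longrightarrow> K \<le> D"
  shows "ereal K \<le> ext_const (S :: 'a::metric_space set) TYPE('b::metric_space)"
  unfolding ext_const_def
proof (rule INF_greatest, clarify)
  fix D :: real
  assume D: "D \<ge> 1" and ext: "\<forall>f :: 'a \<Rightarrow> 'b. Lip S f < \<infinity> \<longrightarrow>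
    (\<exists>g. (\<forall>x\<in>S. g x = f x) \<and> Lip UNIV g < \<infinity> \<and> Lip UNIV g \<le> ereal D * Lip S f)"
  have "K \<le> D"
  proof (rule assms[OF D])
    fix f :: "'a \<Rightarrow> 'b"
    assume "1-lipschitz_on S f"
    then have Lip: "Lip S f \<le> 1"
      unfolding Lip_def by (intro INF_lower2[of 1]) auto
    then have "Lip S f < \<infinity>"
      by auto
    with ext obtain g where g: "\<forall>x\<in>S. g x = f x" "Lip UNIV g \<le> ereal D * Lip S f"
      by blast
    have "ereal D * Lip S f \<le> ereal D * 1"
      using Lip D by (intro ereal_mult_left_mono) auto
    with g(2) have "Lip UNIV g \<le> ereal D"
      by simp
    with g(1) show "\<exists>g. (\<forall>x\<in>S. g x = f x) \<and> (\<forall>x y. dist (g x) (g y) \<le> D * dist x y)"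
      using dist_le_of_Lip_le by blast
  qed
  then show "ereal K \<le> ereal D" by simp
qed

text \<open>
  One set serves for all \<open>n\<close>: the basis vectors with index at least \<open>n\<close> are mapped to the constant
  function \<open>\<surd>2\<close>, which is orthogonal to the Rademacher functions and so keeps the map \<open>1\<close>-Lipschitz.
\<close>

lemma ext_const_basis_ell2_ell1_ge: "ereal (sqrt 2) \<le> ext_const (range unit_ell2) TYPE(ell1)"
proof (rule ext_const_geI)
  fix D :: real
  assume ext: "\<And>f :: ell2 \<Rightarrow> ell1. 1-lipschitz_on (range unit_ell2) f \<Longrightarrow>
    \<exists>g. (\<forall>x\<in>range unit_ell2. g x = f x) \<and> (\<forall>x y. dist (g x) (g y) \<le> D * dist x y)"
  have bound: "sqrt 2 * (1 - 1 / m) \<le> D" if "m > 0" for m :: nat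
  proof -
    \<comment> \<open>A square number of points keeps the bound free of roots of \<open>n\<close>.\<close>
    define n where "n = m\<^sup>2"
    define f where "f = rad_ell1 n \<circ> inv unit_ell2"
    have f: "f (unit_ell2 i) = rad_ell1 n i" for i
      by (simp add: f_def inv_f_f[OF inj_unit_ell2])
    have "1-lipschitz_on (range unit_ell2) f"
      by (rule lipschitz_onI) (auto simp: f dist_unit_ell2 dist_rad_ell1_le)
    then obtain g where g: "\<And>i. g (unit_ell2 i) = rad_ell1 n i"
      and lip: "\<And>x y. dist (g x) (g y) \<le> D * dist x y"
      using ext f by (metis rangeI)
    have "sqrt 2 * (n - sqrt n) \<le> (\<Sum>i<n. dist (g 0) (rad_ell1 n i))"
      by (rule sum_dist_rad_ell1_ge)
    also have "\<dots> \<le> (\<Sum>i<n. D)"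
    proof (rule sum_mono)
      show "dist (g 0) (rad_ell1 n i) \<le> D" for i
        using lip[of 0 "unit_ell2 i"] by (simp add: g norm_unit_ell2)
    qed
    finally have "(sqrt 2 * (1 - 1 / m)) * real n \<le> D * real n"
      using that by (simp add: n_def power2_eq_square algebra_simps)
    then show ?thesis
      using that by (simp add: n_def)
  qed
  show "sqrt 2 \<le> D"
  proof (rule LIMSEQ_le_const2)
    show "(\<lambda>m. sqrt 2 * (1 - 1 / real m)) \<longlonglongrightarrow> sqrt 2"
      using tendsto_mult[OF tendsto_const tendsto_diff[OF tendsto_const lim_1_over_n], of "sqrt 2" 1]
      by simp
    show "\<exists>N. \<forall>m\<ge>N. sqrt 2 * (1 - 1 / real m) \<le> D"
      using bound by (intro exI[of _ 1]) auto
  qed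
qed

theorem mainTheorem6: "abs_ext_const TYPE(ell2) TYPE(ell1) \<ge> ereal (sqrt 2)"
  unfolding abs_ext_const_def
  by (rule SUP_upper2[where i = "range unit_ell2"]) (simp_all add: ext_const_basis_ell2_ell1_ge)

end
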